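(* Let $K$ be a simplicial complex on $m$ vertices. Then $s_2(K)\leq s_p(K)$ for all primes \[ p>\frac{(m-s_2(K)+1)^{\frac{m-s_2(K)+1}{2}}}{2^{m-s_2(K)}}. \]
   Context: For a prime $p$ and an integer $n\ge 0$, the universal simplicial complex $X(\mathbb{F}_p^n)$ is the abstract simplicial complex whose vertices are the nonzero vectors of $\mathbb{F}_p^n$ and whose simplices are the sets of vectors that are linearly independent over $\mathbb{F}_p$. A simplicial map is nondegenerate if it is injective on the vertex set of every simplex (equivalently, it maps every $j$-simplex onto a $j$-simplex). For a finite simplicial complex $\mathcal{K}$ with $m$ vertices and a prime $p$, the mod $p$ Buchstaber invariant of $\mathcal{K}$ is the integer $s_p(\mathcal{K})=m-r$, where $r$ is the least integer such that there is a nondegenerate simplicial map $\mathcal{K}\to X(\mathbb{F}_p^r)$. *)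

theory Defs
  imports
    "Jordan_Normal_Form.VS_Connect"
    "HOL-Number_Theory.Residues"
    Complex_Main
begin

text \<open>
  An abstract simplicial complex is given by its set of simplices.  The empty simplex is always
  included, and the vertices are the points that lie in some simplex (there are no ghost vertices).
\<close>

definition simplicial_complex :: "'a set set \<Rightarrow> bool" where
  "simplicial_complex K \<longleftrightarrow>
     {} \<in> K \<and> (\<forall>\<sigma>\<in>K. finite \<sigma>) \<and> (\<forall>\<sigma>\<in>K. \<forall>\<tau>. \<tau> \<subseteq> \<sigma> \<longrightarrow> \<tau> \<in> K)"

definition vertices :: "'a set set \<Rightarrow> 'a set" where
  "vertices K = \<Union>K"

text \<open>The values of a simplicial map outside \<open>vertices K\<close> are irrelevant.\<close>

definition simplicial_map :: "'a set set \<Rightarrow> 'b set set \<Rightarrow> ('a \<Rightarrow> 'b) \<Rightarrow> bool" where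
  "simplicial_map K L f \<longleftrightarrow> (\<forall>\<sigma>\<in>K. f ` \<sigma> \<in> L)"

definition nondegenerate_map :: "'a set set \<Rightarrow> 'b set set \<Rightarrow> ('a \<Rightarrow> 'b) \<Rightarrow> bool" where
  "nondegenerate_map K L f \<longleftrightarrow> simplicial_map K L f \<and> (\<forall>\<sigma>\<in>K. inj_on f \<sigma>)"

text \<open>
  \<open>Fp_space p n\<close> is the coordinate space of dimension \<open>n\<close> over the field with \<open>p\<close> elements,
  with coordinates indexed by \<open>{..<n}\<close>; it is only meaningful for prime \<open>p\<close>.
\<close>

abbreviation Fp_space :: "nat \<Rightarrow> nat \<Rightarrow> (int, nat \<Rightarrow> int) module" where
  "Fp_space p n \<equiv> LinearCombinations.ring.func_space (residue_ring (int p)) {..<n}"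

definition universal_complex :: "nat \<Rightarrow> nat \<Rightarrow> (nat \<Rightarrow> int) set set" where
  "universal_complex p n =
     {\<sigma>. finite \<sigma> \<and> \<sigma> \<subseteq> carrier (Fp_space p n) \<and>
         \<not> LinearCombinations.module.lin_dep (residue_ring (int p)) (Fp_space p n) \<sigma>}"

definition buchstaber_rank :: "nat \<Rightarrow> 'a set set \<Rightarrow> nat" where
  "buchstaber_rank p K = (LEAST r. \<exists>f. nondegenerate_map K (universal_complex p r) f)"

definition buchstaber :: "nat \<Rightarrow> 'a set set \<Rightarrow> int" where
  "buchstaber p K = int (card (vertices K)) - int (buchstaber_rank p K)"


subsection \<open>Consistency of the definitions\<close>

lemma Fp_field: "prime p \<Longrightarrow> field (residue_ring (int p))"
  using residues_prime.is_field residues_prime.intro by blast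

lemma Fp_vectorspace:
  assumes "prime p"
  shows "vectorspace (residue_ring (int p)) (Fp_space p n)"
proof -
  interpret field "residue_ring (int p)"
    using Fp_field[OF assms] .
  show ?thesis
    using func_space_is_module field_axioms unfolding vectorspace_def by blast
qed

lemma simplicial_complex_universal:
  assumes "prime p"
  shows "simplicial_complex (universal_complex p n)"
proof -
  interpret V: vectorspace "residue_ring (int p)" "Fp_space p n"
    using Fp_vectorspace[OF assms] .
  have "V.lin_indpt {}"
    by (auto simp: V.lin_dep_def)
  moreover have "V.lin_indpt \<tau>" if "V.lin_indpt \<sigma>" "\<tau> \<subseteq> \<sigma>" for \<sigma> \<tau>
    using that unfolding V.lin_dep_def by blast
  ultimately show ?thesis
    unfolding simplicial_complex_def universal_complex_def
    by (auto intro: finite_subset)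
qed

lemma vertices_universal:
  assumes "prime p"
  shows "vertices (universal_complex p n) =
           carrier (Fp_space p n) - {\<zero>\<^bsub>Fp_space p n\<^esub>}"
proof -
  let ?R = "residue_ring (int p)" and ?V = "Fp_space p n"
  interpret V: vectorspace ?R ?V
    using Fp_vectorspace[OF assms] .
  have "v \<in> carrier ?V - {\<zero>\<^bsub>?V\<^esub>}" if "\<sigma> \<in> universal_complex p n" "v \<in> \<sigma>" for v \<sigma>
    using that V.vs_zero_lin_dep[of \<sigma>] unfolding universal_complex_def by auto
  moreover have "{v} \<in> universal_complex p n"
    if v: "v \<in> carrier ?V" "v \<noteq> \<zero>\<^bsub>?V\<^esub>" for v
  proof -
    have "V.lin_indpt {v}"
    proof
      assume "V.lin_dep {v}"
      then obtain A a w where *: "A \<subseteq> {v}" "a \<in> A \<rightarrow> carrier ?R"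
        "V.lincomb a A = \<zero>\<^bsub>?V\<^esub>" "w \<in> A" "a w \<noteq> \<zero>\<^bsub>?R\<^esub>"
        unfolding V.lin_dep_def by metis
      then have A: "A = {v}" "w = v" by auto
      have a: "a v \<in> carrier ?R" "a v \<noteq> \<zero>\<^bsub>?R\<^esub>"
        using * A by auto
      have "a v \<odot>\<^bsub>?V\<^esub> v = \<zero>\<^bsub>?V\<^esub>"
        using * A a v(1) by (simp add: V.lincomb_def)
      then have "inv\<^bsub>?R\<^esub> a v \<odot>\<^bsub>?V\<^esub> (a v \<odot>\<^bsub>?V\<^esub> v) = \<zero>\<^bsub>?V\<^esub>"
        using a by simp
      moreover have "inv\<^bsub>?R\<^esub> a v \<odot>\<^bsub>?V\<^esub> (a v \<odot>\<^bsub>?V\<^esub> v) = v"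
        using V.smult_assoc1[of "inv\<^bsub>?R\<^esub> a v" "a v" v] a v V.field_Units V.Units_l_inv[of "a v"]
        by auto
      ultimately show False
        using v by simp
    qed
    then show ?thesis
      using v by (simp add: universal_complex_def)
  qed
  ultimately show ?thesis
    unfolding vertices_def by blast
qed

text \<open>The minimum in \<open>buchstaber_rank\<close> is attained, and \<open>buchstaber p K\<close> is non-negative.\<close>

lemma finsum_Fp_space:
  assumes "prime p" "finite A" "g \<in> A \<rightarrow> carrier (Fp_space p n)" "i < n"
  shows "finsum (Fp_space p n) g A i = finsum (residue_ring (int p)) (\<lambda>x. g x i) A"
proof -
  interpret V: vectorspace "residue_ring (int p)" "Fp_space p n"
    using Fp_vectorspace[OF assms(1)] .
  have zero: "\<zero>\<^bsub>Fp_space p n\<^esub> i = \<zero>\<^bsub>residue_ring (int p)\<^esub>"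
    using assms(4) by (simp add: V.func_space_def)
  have add: "(v \<oplus>\<^bsub>Fp_space p n\<^esub> w) i = v i \<oplus>\<^bsub>residue_ring (int p)\<^esub> w i" for v w
    using assms(4) by (simp add: V.func_space_def)
  have carr: "v i \<in> carrier (residue_ring (int p))" if "v \<in> carrier (Fp_space p n)" for v
    using that assms(4) by (auto simp: V.func_space_def)
  show ?thesis
    using assms(2,3)
  proof (induction A rule: finite_induct)
    case empty
    then show ?case by (simp add: zero)
  next
    case (insert x A)
    then have "(\<lambda>x. g x i) \<in> A \<rightarrow> carrier (residue_ring (int p))"
      "g x i \<in> carrier (residue_ring (int p))"
      using carr by (auto simp: Pi_def)
    with insert show ?case
      by (simp add: add Pi_def)
  qed
qed

lemma nondegenerate_map_exists:
  assumes "prime p" "simplicial_complex K" "finite (vertices K)"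
  shows "\<exists>f. nondegenerate_map K (universal_complex p (card (vertices K))) f"
proof -
  define n where "n = card (vertices K)"
  let ?R = "residue_ring (int p)" and ?V = "Fp_space p n"
  interpret V: vectorspace ?R ?V
    using Fp_vectorspace[OF assms(1)] .
  define e :: "nat \<Rightarrow> nat \<Rightarrow> int" where
    "e j = (\<lambda>i\<in>{..<n}. if i = j then \<one>\<^bsub>?R\<^esub> else \<zero>\<^bsub>?R\<^esub>)" for j
  have e_carr: "e j \<in> carrier ?V" for j
    by (auto simp: V.func_space_def e_def)
  have e_eq: "e j i = (if i = j then \<one>\<^bsub>?R\<^esub> else \<zero>\<^bsub>?R\<^esub>)" if "i < n" for i j
    using that by (simp add: e_def)
  have e_inj: "inj_on e {..<n}"
  proof (rule inj_onI)
    fix i j assume "i \<in> {..<n}" "j \<in> {..<n}" "e i = e j"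
    then show "i = j"
      using e_eq[of i i] e_eq[of i j] V.zero_not_one by (auto split: if_splits)
  qed
  have "V.lin_indpt (e ` {..<n})"
  proof
    assume "V.lin_dep (e ` {..<n})"
    then obtain A a v where *: "finite A" "A \<subseteq> e ` {..<n}" "a \<in> A \<rightarrow> carrier ?R"
      "V.lincomb a A = \<zero>\<^bsub>?V\<^esub>" "v \<in> A" "a v \<noteq> \<zero>\<^bsub>?R\<^esub>"
      unfolding V.lin_dep_def by metis
    then obtain i where i: "i < n" "v = e i" by auto
    have A_carr: "A \<subseteq> carrier ?V"
      using * e_carr by auto
    have "\<zero>\<^bsub>?R\<^esub> = V.lincomb a A i"
      using * i by (simp add: V.func_space_def)
    also have "\<dots> = (\<Oplus>\<^bsub>?R\<^esub>w\<in>A. (a w \<odot>\<^bsub>?V\<^esub> w) i)"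
      unfolding V.lincomb_def
      using finsum_Fp_space[OF assms(1) *(1) _ i(1)] * A_carr by (simp add: Pi_def subset_iff)
    also have "\<dots> = (\<Oplus>\<^bsub>?R\<^esub>w\<in>A. if v = w then a w else \<zero>\<^bsub>?R\<^esub>)"
    proof (rule V.R.finsum_cong')
      fix w assume w: "w \<in> A"
      then obtain j where j: "j < n" "w = e j" using * by auto
      have "(a w \<odot>\<^bsub>?V\<^esub> w) i = a w \<otimes>\<^bsub>?R\<^esub> w i"
        using i by (simp add: V.func_space_def)
      moreover have "a w \<in> carrier ?R" using * w by auto
      moreover have "v = w \<longleftrightarrow> i = j"
        using i j inj_onD[OF e_inj] by auto
      ultimately show "(a w \<odot>\<^bsub>?V\<^esub> w) i = (if v = w then a w else \<zero>\<^bsub>?R\<^esub>)"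
        using j e_eq[OF i(1), of j] by auto
    qed (use * in auto)
    also have "\<dots> = a v"
      using * by (intro V.R.finsum_singleton) auto
    finally show False using * by simp
  qed
  then have all: "e ` {..<n} \<in> universal_complex p n"
    using e_carr by (auto simp: universal_complex_def)
  obtain h where h: "bij_betw h (vertices K) {..<n}"
    using assms(3) finite_same_card_bij[of "vertices K" "{..<n}"] n_def card_lessThan
    by (metis finite_lessThan)
  have "nondegenerate_map K (universal_complex p n) (e \<circ> h)"
    unfolding nondegenerate_map_def simplicial_map_def
  proof (intro conjI ballI)
    fix \<sigma> assume "\<sigma> \<in> K"
    then have \<sigma>: "\<sigma> \<subseteq> vertices K" by (auto simp: vertices_def)
    then have "(e \<circ> h) ` \<sigma> \<subseteq> e ` {..<n}"
      using h by (auto simp: bij_betw_def)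
    then show "(e \<circ> h) ` \<sigma> \<in> universal_complex p n"
      using all simplicial_complex_universal[OF assms(1)] unfolding simplicial_complex_def by blast
    have "inj_on (e \<circ> h) (vertices K)"
      using h e_inj by (intro comp_inj_on) (auto simp: bij_betw_def)
    then show "inj_on (e \<circ> h) \<sigma>"
      using \<sigma> inj_on_subset by blast
  qed
  then show ?thesis
    unfolding n_def by blast
qed

lemma buchstaber_rank_attained:
  assumes "prime p" "simplicial_complex K" "finite (vertices K)"
  shows "\<exists>f. nondegenerate_map K (universal_complex p (buchstaber_rank p K)) f"
  unfolding buchstaber_rank_def
  by (rule LeastI[where P = "\<lambda>r. \<exists>f. nondegenerate_map K (universal_complex p r) f"])
    (rule nondegenerate_map_exists[OF assms])

lemma buchstaber_nonneg:
  assumes "prime p" "simplicial_complex K" "finite (vertices K)"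
  shows "0 \<le> buchstaber p K"
  unfolding buchstaber_def buchstaber_rank_def
  using Least_le[where P = "\<lambda>r. \<exists>f. nondegenerate_map K (universal_complex p r) f",
      OF nondegenerate_map_exists[OF assms]]
  by simp

end

theory Submission
  imports Defs
begin

text \<open>
  Write \<open>r\<close> for the number \<open>m - buchstaber 2 K\<close>, the least dimension for which a nondegenerate map
  from \<open>K\<close> to the universal complex over \<open>F\<^sub>2\<close> exists.  The vertices of that universal complex are
  vectors with entries \<open>0\<close> and \<open>1\<close>, and these entries also make sense over \<open>F\<^sub>p\<close>.  For \<open>p\<close> above
  the stated bound every set of such vectors that is independent over \<open>F\<^sub>2\<close> is independent over
  \<open>F\<^sub>p\<close>, so the first universal complex is a subcomplex of the second
  (\<open>universal_complex_subset_if_large_prime\<close>).  Hence the map for the prime \<open>2\<close> is itself a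
  nondegenerate map for \<open>p\<close>, and the rank for \<open>p\<close> is at most \<open>r\<close>.

  Independence passes from \<open>2\<close> to \<open>p\<close> through one integer determinant.  An independent set over
  \<open>F\<^sub>2\<close> can be completed by the exchange theorem to the rows of a square \<open>0\<close>-\<open>1\<close> matrix \<open>A\<close> of size
  \<open>r\<close> that is invertible modulo \<open>2\<close>, so \<open>det A\<close> is odd and in particular nonzero
  (\<open>square_matrix_extending_independent\<close>).  Hadamard's inequality for \<open>0\<close>-\<open>1\<close> matrices says
  \<open>4 ^ r * (det A)\<^sup>2 \<le> (r + 1) ^ (r + 1)\<close> (\<open>det_zero_one_matrix_bound\<close>), and the bound on \<open>p\<close> is exactly
  what makes this force \<open>\<bar>det A\<bar> < p\<close>.  So \<open>p\<close> does not divide \<open>det A\<close>, and the rows of \<open>A\<close> are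
  independent modulo \<open>p\<close> too (\<open>dvd_coeffs_if_not_dvd_det\<close>).
\<close>

section \<open>Hadamard's inequality\<close>

text \<open>
  One step of Gaussian elimination without division: the multipliers \<open>c\<close> are supplied, which leaves
  room for the case that the pivot vanishes together with the column below it.
\<close>

lemma det_clear_first_column:
  fixes G :: "'a :: idom mat"
  assumes G: "G \<in> carrier_mat (Suc n) (Suc n)"
    and c: "\<And>i. i < n \<Longrightarrow> G $$ (Suc i, 0) = c i * G $$ (0, 0)"
  shows "det G = G $$ (0, 0) *
    det (mat n n (\<lambda>(i, j). G $$ (Suc i, Suc j) - c i * G $$ (0, Suc j)))"
proof -
  define S where "S = mat n n (\<lambda>(i, j). G $$ (Suc i, Suc j) - c i * G $$ (0, Suc j))"
  define E where "E = mat (Suc n) (Suc n)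
    (\<lambda>(i, j). if i = j then 1 else if j = 0 then - c (i - 1) else 0)"
  define T where "T = four_block_mat (mat 1 1 (\<lambda>_. G $$ (0, 0)))
    (mat 1 n (\<lambda>(i, j). G $$ (0, Suc j))) (0\<^sub>m n 1) S"
  have E: "E \<in> carrier_mat (Suc n) (Suc n)"
    by (simp add: E_def)
  have "det E = prod_list (diag_mat E)"
    by (rule det_lower_triangular[OF _ E]) (auto simp: E_def)
  also have "diag_mat E = map (\<lambda>i. 1) [0..<Suc n]"
    unfolding diag_mat_def by (rule map_cong) (auto simp: E_def)
  finally have det_E: "det E = 1"
    by (simp add: map_replicate_const)
  have "E * G = T"
  proof (rule eq_matI)
    fix i j assume "i < dim_row T" "j < dim_col T"
    then have i: "i < Suc n" and j: "j < Suc n"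
      by (auto simp: T_def S_def)
    have EG: "(E * G) $$ (i, j) = (\<Sum>k<Suc n. E $$ (i, k) * G $$ (k, j))"
      using i j E G by (auto simp: scalar_prod_def atLeast0LessThan intro!: sum.cong)
    show "(E * G) $$ (i, j) = T $$ (i, j)"
    proof (cases i)
      case 0
      have "(E * G) $$ (i, j) = (\<Sum>k<Suc n. if k = 0 then G $$ (0, j) else 0)"
        unfolding EG using 0 by (intro sum.cong) (auto simp: E_def)
      also have "\<dots> = G $$ (0, j)"
        by simp
      finally show ?thesis
        using 0 j by (cases j) (auto simp: T_def S_def)
    next
      case (Suc i')
      have "(E * G) $$ (i, j) =
          (\<Sum>k<Suc n. (if k = 0 then - c i' * G $$ (0, j) else 0) +
            (if k = i then G $$ (i, j) else 0))"
        unfolding EG using Suc i by (intro sum.cong) (auto simp: E_def)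
      also have "\<dots> = - c i' * G $$ (0, j) + G $$ (i, j)"
        using i by (simp add: sum.distrib)
      finally show ?thesis
        using Suc i j c[of i'] by (cases j) (auto simp: T_def S_def)
    qed
  qed (use E G in \<open>auto simp: T_def S_def\<close>)
  then have "det E * det G = det T"
    using det_mult[OF E G] by simp
  also have "\<dots> = det (mat 1 1 (\<lambda>_. G $$ (0, 0))) * det S"
    unfolding T_def
    by (rule det_four_block_mat_lower_left_zero_col) (auto simp: S_def)
  finally show ?thesis
    by (simp add: det_E S_def det_single)
qed

text \<open>
  This is Hadamard's inequality for the rows \<open>v i\<close>.  Eliminating the first column of the Gram matrix
  leaves the Gram matrix of the vectors \<open>w i\<close>, the components of the remaining rows orthogonal to the
  first row; taking this component does not increase the norm, so induction applies.
\<close>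

lemma det_Gram_le_prod_norms:
  fixes v :: "nat \<Rightarrow> nat \<Rightarrow> real"
  shows "det (mat n n (\<lambda>(i, j). \<Sum>t<N. v i t * v j t)) \<le> (\<Prod>i<n. \<Sum>t<N. (v i t)\<^sup>2)"
proof (induction n arbitrary: v)
  case 0
  then show ?case by simp
next
  case (Suc n)
  define G where "G = mat (Suc n) (Suc n) (\<lambda>(i, j). \<Sum>t<N. v i t * v j t)"
  define q where "q = (\<Sum>t<N. (v 0 t)\<^sup>2)"
  have G: "G \<in> carrier_mat (Suc n) (Suc n)"
    by (simp add: G_def)
  have G00: "G $$ (0, 0) = q"
    by (simp add: G_def q_def power2_eq_square)
  have q_nonneg: "0 \<le> q"
    by (simp add: q_def sum_nonneg)
  \<comment> \<open>If \<open>q = 0\<close>, then \<open>v 0\<close> vanishes on \<open>{..<N}\<close>, and the value \<open>0\<close> of the quotient is the right one.\<close>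
  define c where "c i = G $$ (Suc i, 0) / q" for i
  define w where "w i t = v (Suc i) t - c i * v 0 t" for i t
  have cq: "(\<Sum>t<N. v (Suc i) t * v 0 t) = c i * q" if "i < n" for i
  proof (cases "q = 0")
    case True
    then have "v 0 t = 0" if "t < N" for t
      using that unfolding q_def by (subst (asm) sum_nonneg_eq_0_iff) auto
    then show ?thesis
      using True by simp
  next
    case False
    then show ?thesis
      using that by (simp add: c_def G_def)
  qed
  have inner_w: "(\<Sum>t<N. w i t * w j t) =
      (\<Sum>t<N. v (Suc i) t * v (Suc j) t) - c i * c j * q" if "i < n" "j < n" for i j
  proof -
    have "(\<Sum>t<N. w i t * w j t) =
        (\<Sum>t<N. v (Suc i) t * v (Suc j) t) - c i * (\<Sum>t<N. v (Suc j) t * v 0 t)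
        - c j * (\<Sum>t<N. v (Suc i) t * v 0 t) + c i * c j * q"
      unfolding w_def q_def sum_distrib_left sum_subtractf[symmetric] sum.distrib[symmetric]
      by (rule sum.cong) (auto simp: algebra_simps power2_eq_square)
    then show ?thesis
      using that by (simp add: cq)
  qed
  have "det G = q * det (mat n n (\<lambda>(i, j). G $$ (Suc i, Suc j) - c i * G $$ (0, Suc j)))"
    using det_clear_first_column[OF G, of c] cq G00 by (simp add: G_def)
  also have "mat n n (\<lambda>(i, j). G $$ (Suc i, Suc j) - c i * G $$ (0, Suc j)) =
      mat n n (\<lambda>(i, j). \<Sum>t<N. w i t * w j t)"
  proof (rule cong_mat)
    fix i j assume ij: "i < n" "j < n"
    have "G $$ (0, Suc j) = c j * q"
      using cq[of j] ij by (simp add: G_def mult.commute)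
    then show "(case (i, j) of (i, j) \<Rightarrow> G $$ (Suc i, Suc j) - c i * G $$ (0, Suc j)) =
        (case (i, j) of (i, j) \<Rightarrow> \<Sum>t<N. w i t * w j t)"
      using ij inner_w[of i j] by (simp add: G_def)
  qed auto
  also have "q * det (mat n n (\<lambda>(i, j). \<Sum>t<N. w i t * w j t)) \<le> q * (\<Prod>i<n. \<Sum>t<N. (w i t)\<^sup>2)"
    using Suc.IH q_nonneg by (intro mult_left_mono)
  also have "\<dots> \<le> q * (\<Prod>i<n. \<Sum>t<N. (v (Suc i) t)\<^sup>2)"
  proof (intro mult_left_mono prod_mono conjI)
    fix i assume "i \<in> {..<n}"
    then have "(\<Sum>t<N. (w i t)\<^sup>2) = (\<Sum>t<N. (v (Suc i) t)\<^sup>2) - (c i)\<^sup>2 * q"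
      using inner_w[of i i] by (simp add: power2_eq_square)
    then show "(\<Sum>t<N. (w i t)\<^sup>2) \<le> (\<Sum>t<N. (v (Suc i) t)\<^sup>2)"
      using q_nonneg by simp
  qed (auto simp: q_nonneg sum_nonneg)
  also have "\<dots> = (\<Prod>i<Suc n. \<Sum>t<N. (v i t)\<^sup>2)"
    by (simp add: q_def prod.lessThan_Suc_shift del: prod.lessThan_Suc)
  finally show ?case
    by (simp add: G_def)
qed

lemma Hadamard_det_sign_matrix:
  fixes M :: "real mat"
  assumes M: "M \<in> carrier_mat n n"
    and sign: "\<And>i j. i < n \<Longrightarrow> j < n \<Longrightarrow> \<bar>M $$ (i, j)\<bar> = 1"
  shows "(det M)\<^sup>2 \<le> real n ^ n"
proof -
  have "(det M)\<^sup>2 = det M * det (transpose_mat M)"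
    using det_transpose[OF M] by (simp add: power2_eq_square)
  also have "\<dots> = det (M * transpose_mat M)"
    using M by (simp add: det_mult)
  also have "M * transpose_mat M = mat n n (\<lambda>(i, j). \<Sum>t<n. M $$ (i, t) * M $$ (j, t))"
    using M by (intro eq_matI) (auto simp: scalar_prod_def atLeast0LessThan intro!: sum.cong)
  also have "det \<dots> \<le> (\<Prod>i<n. \<Sum>t<n. (M $$ (i, t))\<^sup>2)"
    by (rule det_Gram_le_prod_norms)
  also have "\<dots> = (\<Prod>i<n. \<Sum>t<n. 1)"
    using sign by (intro prod.cong sum.cong) (auto simp flip: abs_square_eq_1)
  finally show ?thesis
    by simp
qed

text \<open>
  Hadamard's inequality for the rows of \<open>A\<close> itself would give only \<open>(det A)\<^sup>2 \<le> n ^ n\<close>.  The sharper bound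
  comes from bordering \<open>A\<close> to a sign matrix \<open>M\<close> of size \<open>n + 1\<close> with \<open>det M = 2 ^ n * det A\<close>: the top row
  of \<open>M\<close> is constant \<open>1\<close>, and adding it to each of the other rows turns \<open>(-1, 2 a - 1)\<close> into
  \<open>(0, 2 a)\<close>.
\<close>

lemma det_zero_one_matrix_bound:
  fixes A :: "int mat"
  assumes A: "A \<in> carrier_mat n n"
    and zero_one: "\<And>i j. i < n \<Longrightarrow> j < n \<Longrightarrow> A $$ (i, j) \<in> {0, 1}"
  shows "4 ^ n * (real_of_int (det A))\<^sup>2 \<le> (real n + 1) ^ (n + 1)"
proof -
  define M :: "real mat" where "M = mat (Suc n) (Suc n)
    (\<lambda>(i, j). if i = 0 then 1 else if j = 0 then -1 else 2 * of_int (A $$ (i - 1, j - 1)) - 1)"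
  have M: "M \<in> carrier_mat (Suc n) (Suc n)"
    by (simp add: M_def)
  have "det M = det (mat n n (\<lambda>(i, j). M $$ (Suc i, Suc j) - (-1) * M $$ (0, Suc j)))"
    using det_clear_first_column[OF M, of "\<lambda>_. -1"] by (simp add: M_def)
  also have "mat n n (\<lambda>(i, j). M $$ (Suc i, Suc j) - (-1) * M $$ (0, Suc j)) =
      2 \<cdot>\<^sub>m map_mat real_of_int A"
    using A by (intro eq_matI) (auto simp: M_def)
  also have "det \<dots> = 2 ^ n * of_int (det A)"
    using A by (simp)
  finally have det_M: "det M = 2 ^ n * of_int (det A)" .
  have "\<bar>M $$ (i, j)\<bar> = 1" if "i < Suc n" "j < Suc n" for i j
    using that zero_one[of "i - 1" "j - 1"] by (cases i; cases j) (auto simp: M_def)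
  then have "(det M)\<^sup>2 \<le> real (Suc n) ^ Suc n"
    by (intro Hadamard_det_sign_matrix[OF M])
  moreover have "(det M)\<^sup>2 = 4 ^ n * (real_of_int (det A))\<^sup>2"
    by (simp add: det_M power_mult_distrib) (simp add: power2_eq_square flip: power_mult_distrib)
  ultimately show ?thesis
    by (simp add: add.commute)
qed

section \<open>Integer matrices modulo a number\<close>

lemma det_cong:
  fixes A B :: "int mat"
  assumes "A \<in> carrier_mat n n" "B \<in> carrier_mat n n"
    and "\<And>i j. i < n \<Longrightarrow> j < n \<Longrightarrow> [A $$ (i, j) = B $$ (i, j)] (mod m)"
  shows "[det A = det B] (mod m)"
  unfolding det_def'[OF assms(1)] det_def'[OF assms(2)]
  by (intro cong_sum cong_mult cong_prod cong_refl assms(3))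
     (auto simp: permutes_in_image)

text \<open>
  Multiplying the row vector \<open>d A\<close> by the adjugate of \<open>A\<close> gives \<open>det A * d\<close>.  The adjugate stays within
  the integers, so independence of the rows modulo \<open>p\<close> needs no linear algebra over \<open>F\<^sub>p\<close>.
\<close>

lemma dvd_coeffs_if_not_dvd_det:
  fixes A :: "int mat" and d :: "nat \<Rightarrow> int"
  assumes A: "A \<in> carrier_mat n n" and p: "prime p" and det: "\<not> p dvd det A"
    and dvd: "\<And>j. j < n \<Longrightarrow> p dvd (\<Sum>i<n. d i * A $$ (i, j))"
    and k: "k < n"
  shows "p dvd d k"
proof -
  note adj = adj_mat[OF A]
  have A_adj: "(\<Sum>j<n. A $$ (i, j) * adj_mat A $$ (j, k)) = (if i = k then det A else 0)"
    if "i < n" for i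
  proof -
    have "(\<Sum>j<n. A $$ (i, j) * adj_mat A $$ (j, k)) = (A * adj_mat A) $$ (i, k)"
      using that k A adj(1)
      by (auto simp: scalar_prod_def atLeast0LessThan intro!: sum.cong)
    then show ?thesis
      using that k by (simp add: adj(2))
  qed
  have "(\<Sum>j<n. (\<Sum>i<n. d i * A $$ (i, j)) * adj_mat A $$ (j, k)) =
      (\<Sum>i<n. d i * (\<Sum>j<n. A $$ (i, j) * adj_mat A $$ (j, k)))"
    unfolding sum_distrib_left sum_distrib_right by (subst sum.swap) (simp add: mult.assoc)
  also have "\<dots> = (\<Sum>i<n. if i = k then d k * det A else 0)"
    by (rule sum.cong) (auto simp: A_adj)
  also have "\<dots> = d k * det A"
    using k by simp
  finally have "p dvd d k * det A"
    using dvd by (metis (no_types, lifting) dvd_mult2 dvd_sum lessThan_iff)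
  then show ?thesis
    using p det by (simp add: prime_dvd_mult_iff)
qed

section \<open>Coordinate spaces over prime fields\<close>

lemma residue_ring_simps:
  "carrier (residue_ring m) = {0..<m}"
  "\<zero>\<^bsub>residue_ring m\<^esub> = 0"
  "x \<oplus>\<^bsub>residue_ring m\<^esub> y = (x + y) mod m"
  "x \<otimes>\<^bsub>residue_ring m\<^esub> y = x * y mod m"
  by (auto simp: residue_ring_def)

lemma carrier_Fp_space: "carrier (Fp_space p n) = {..<n} \<rightarrow>\<^sub>E {0..<int p}" if "prime p"
proof -
  interpret field "residue_ring (int p)" using Fp_field[OF that] .
  show ?thesis
    by (simp add: func_space_def residue_ring_simps)
qed

lemma finsum_residue_ring:
  assumes "prime p" "finite A" "g \<in> A \<rightarrow> carrier (residue_ring (int p))"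
  shows "finsum (residue_ring (int p)) g A = (\<Sum>x\<in>A. g x) mod int p"
proof -
  interpret field "residue_ring (int p)" using Fp_field[OF assms(1)] .
  show ?thesis
    using assms(2,3)
  proof (induction A rule: finite_induct)
    case empty
    then show ?case by (simp add: residue_ring_simps)
  next
    case (insert x A)
    then have "finsum (residue_ring (int p)) g (insert x A) =
        (g x + (\<Sum>x\<in>A. g x) mod int p) mod int p"
      by (simp add: Pi_def) (simp add: residue_ring_simps)
    then show ?case
      using insert by (simp add: mod_simps)
  qed
qed

text \<open>
  Linear combinations over \<open>F\<^sub>p\<close> are integer sums reduced modulo \<open>p\<close>; this is the bridge between the
  abstract vector space and integer matrices.
\<close>

lemma lincomb_Fp_space:
  assumes p: "prime p" and A: "finite A" "A \<subseteq> carrier (Fp_space p n)"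
    and a: "a \<in> A \<rightarrow> carrier (residue_ring (int p))" and i: "i < n"
  shows "LinearCombinations.module.lincomb (Fp_space p n) a A i = (\<Sum>w\<in>A. a w * w i) mod int p"
proof -
  interpret V: vectorspace "residue_ring (int p)" "Fp_space p n"
    using Fp_vectorspace[OF p] .
  have smult: "(a w \<odot>\<^bsub>Fp_space p n\<^esub> w) i = (a w * w i) mod int p" for w
    using i by (simp add: V.func_space_def residue_ring_simps)
  have "V.lincomb a A i = finsum (residue_ring (int p)) (\<lambda>w. (a w \<odot>\<^bsub>Fp_space p n\<^esub> w) i) A"
    unfolding V.lincomb_def
    by (rule finsum_Fp_space[OF p A(1) _ i]) (use A a in \<open>auto simp: Pi_def\<close>)
  also have "\<dots> = (\<Sum>w\<in>A. (a w * w i) mod int p) mod int p"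
    unfolding smult using prime_gt_0_nat[OF p]
    by (intro finsum_residue_ring[OF p A(1)]) (auto simp: residue_ring_simps)
  finally show ?thesis
    by (simp add: mod_sum_eq)
qed

definition unit_fun :: "nat \<Rightarrow> nat \<Rightarrow> nat \<Rightarrow> int" where
  "unit_fun n l = (\<lambda>i\<in>{..<n}. if i = l then 1 else 0)"

lemma unit_fun_apply: "i < n \<Longrightarrow> unit_fun n l i = (if i = l then 1 else 0)"
  by (simp add: unit_fun_def)

lemma unit_fun_in_Fp_space: "prime p \<Longrightarrow> unit_fun n l \<in> carrier (Fp_space p n)"
  using prime_gt_1_nat[of p] by (auto simp: carrier_Fp_space unit_fun_def)

lemma inj_on_unit_fun: "inj_on (unit_fun n) {..<n}"
proof (rule inj_onI)
  fix i j assume ij: "i \<in> {..<n}" "j \<in> {..<n}" "unit_fun n i = unit_fun n j"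
  then have "unit_fun n i i = unit_fun n j i"
    by simp
  then show "i = j"
    using ij(1) by (auto simp: unit_fun_apply split: if_splits)
qed

lemma span_unit_funs:
  assumes p: "prime p"
  shows "LinearCombinations.module.span (residue_ring (int p)) (Fp_space p n)
    (unit_fun n ` {..<n}) = carrier (Fp_space p n)"
proof -
  let ?U = "unit_fun n ` {..<n}"
  interpret V: vectorspace "residue_ring (int p)" "Fp_space p n"
    using Fp_vectorspace[OF p] .
  have U: "?U \<subseteq> carrier (Fp_space p n)"
    using unit_fun_in_Fp_space[OF p] by auto
  have "v \<in> V.span ?U" if v: "v \<in> carrier (Fp_space p n)" for v
  proof -
    define a where "a w = v (inv_into {..<n} (unit_fun n) w)" for w
    have a_unit: "a (unit_fun n l) = v l" if "l < n" for l
      using that inv_into_f_f[OF inj_on_unit_fun] by (simp add: a_def)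
    have v_range: "v \<in> {..<n} \<rightarrow>\<^sub>E {0..<int p}"
      using v carrier_Fp_space[OF p] by simp
    have a: "a \<in> ?U \<rightarrow> carrier (residue_ring (int p))"
      using v_range a_unit by (auto simp: residue_ring_simps PiE_def Pi_def)
    have "V.lincomb a ?U = v"
    proof (rule PiE_ext)
      show "V.lincomb a ?U \<in> {..<n} \<rightarrow>\<^sub>E {0..<int p}"
        using V.lincomb_closed[OF U a] carrier_Fp_space[OF p] by simp
      fix i assume "i \<in> {..<n}"
      then have i: "i < n" by simp
      have "V.lincomb a ?U i = (\<Sum>w\<in>?U. a w * w i) mod int p"
        by (rule lincomb_Fp_space[OF p _ U a i]) simp
      also have "(\<Sum>w\<in>?U. a w * w i) = (\<Sum>l<n. a (unit_fun n l) * unit_fun n l i)"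
        by (simp add: sum.reindex[OF inj_on_unit_fun])
      also have "\<dots> = (\<Sum>l<n. if l = i then v i else 0)"
        using i by (intro sum.cong) (auto simp: a_unit unit_fun_apply)
      also have "\<dots> = v i"
        using i by simp
      finally show "V.lincomb a ?U i = v i"
        using v_range i by (auto simp: PiE_def Pi_def)
    qed (use v_range in auto)
    then show ?thesis
      unfolding V.span_def using a by blast
  qed
  then show ?thesis
    using V.span_closed[OF U] by blast
qed

text \<open>
  The exchange theorem, applied to \<open>\<sigma>\<close> and the unit vectors, gives a spanning set \<open>S\<close> with at most \<open>n\<close>
  elements that contains \<open>\<sigma>\<close>.  Its elements, padded with zero rows, form \<open>A\<close>.  As each unit vector is
  a combination of rows of \<open>A\<close>, there is \<open>B\<close> with \<open>B A\<close> congruent to the identity, so \<open>det A\<close> is a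
  unit modulo \<open>p\<close>.  The map \<open>h\<close> tells which row a vector of \<open>\<sigma>\<close> occupies.
\<close>

lemma square_matrix_extending_independent:
  assumes p: "prime p" and \<sigma>: "\<sigma> \<in> universal_complex p n"
  obtains A h where "A \<in> carrier_mat n n" "\<not> int p dvd det A"
    "\<And>i j. i < n \<Longrightarrow> j < n \<Longrightarrow> A $$ (i, j) \<in> {0..<int p}"
    "inj_on h \<sigma>" "h ` \<sigma> \<subseteq> {..<n}"
    "\<And>w j. w \<in> \<sigma> \<Longrightarrow> j < n \<Longrightarrow> A $$ (h w, j) = w j"
proof -
  interpret V: vectorspace "residue_ring (int p)" "Fp_space p n"
    using Fp_vectorspace[OF p] .
  let ?U = "unit_fun n ` {..<n}"
  have \<sigma>': "finite \<sigma>" "\<sigma> \<subseteq> carrier (Fp_space p n)" "V.lin_indpt \<sigma>"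
    using \<sigma> by (auto simp: universal_complex_def)
  have U: "?U \<subseteq> carrier (Fp_space p n)"
    using unit_fun_in_Fp_space[OF p] by auto
  obtain C where C: "finite C" "C \<subseteq> carrier (Fp_space p n)" "C \<inter> \<sigma> = {}"
    "int (card C) \<le> int (card ?U) - int (card \<sigma>)" "V.span (\<sigma> \<union> C) = V.span ?U"
    using V.replacement[OF \<sigma>'(1) _ U \<sigma>'(3)] \<sigma>'(2) span_unit_funs[OF p] by auto
  define S where "S = \<sigma> \<union> C"
  have S: "finite S" "S \<subseteq> carrier (Fp_space p n)" "V.span S = carrier (Fp_space p n)"
    using C \<sigma>' span_unit_funs[OF p] by (auto simp: S_def)
  have "card S = card \<sigma> + card C"
    using C \<sigma>' unfolding S_def by (intro card_Un_disjoint) auto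
  then have card_S: "card S \<le> n"
    using C(4) card_image[OF inj_on_unit_fun, of n] by simp
  obtain h where h: "bij_betw h S {..<card S}"
    using S(1) by (metis ex_bij_betw_finite_nat atLeast0LessThan)
  then have h_inj: "inj_on h S" and h_img: "h ` S = {..<card S}"
    by (auto simp: bij_betw_def)
  have h_less: "h w < n" if "w \<in> S" for w
  proof -
    have "h w \<in> {..<card S}"
      using h_img that by blast
    then show ?thesis
      using card_S by simp
  qed
  define g where "g = inv_into S h"
  have gh: "g (h w) = w" if "w \<in> S" for w
    using that h_inj by (simp add: g_def)
  have g_in: "g i \<in> S" if "i < card S" for i
    using that h_img by (auto simp: g_def intro: inv_into_into)
  define A where "A = mat n n (\<lambda>(i, j). if i < card S then g i j else 0)"
  have A: "A \<in> carrier_mat n n"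
    by (simp add: A_def)
  have A_row: "A $$ (h w, j) = w j" if "w \<in> S" "j < n" for w j
    using that h_less h_img gh by (auto simp: A_def)
  have S_range: "w j \<in> {0..<int p}" if "w \<in> S" "j < n" for w j
    using that S(2) carrier_Fp_space[OF p] by (auto simp: PiE_def Pi_def)
  have "\<exists>b. \<forall>j<n. [(\<Sum>i<n. b i * A $$ (i, j)) = (if l = j then 1 else 0)] (mod int p)"
    if "l < n" for l
  proof -
    have "unit_fun n l \<in> V.span S"
      using S(3) unit_fun_in_Fp_space[OF p] by simp
    then obtain a where a: "a \<in> S \<rightarrow> carrier (residue_ring (int p))"
      "unit_fun n l = V.lincomb a S"
      using V.finite_span[OF S(1,2)] by auto
    define b where "b i = (if i < card S then a (g i) else 0)" for i
    have "[(\<Sum>i<n. b i * A $$ (i, j)) = (if l = j then 1 else 0)] (mod int p)" if j: "j < n" for j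
    proof -
      have "(\<Sum>i<n. b i * A $$ (i, j)) = (\<Sum>i<card S. b i * A $$ (i, j))"
        using card_S by (intro sum.mono_neutral_right) (auto simp: b_def)
      also have "\<dots> = (\<Sum>w\<in>S. b (h w) * A $$ (h w, j))"
        using sum.reindex[OF h_inj, of "\<lambda>i. b i * A $$ (i, j)"] h_img by simp
      also have "\<dots> = (\<Sum>w\<in>S. a w * w j)"
        using h_img j by (intro sum.cong) (auto simp: A_row b_def gh)
      finally have "(\<Sum>i<n. b i * A $$ (i, j)) mod int p = unit_fun n l j"
        using lincomb_Fp_space[OF p S(1,2) a(1) j] a(2) by simp
      then show ?thesis
        using j prime_gt_1_nat[OF p] by (auto simp: cong_def unit_fun_def)
    qed
    then show ?thesis by blast
  qed
  then obtain b where b: "\<And>l j. l < n \<Longrightarrow> j < n \<Longrightarrow>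
      [(\<Sum>i<n. b l i * A $$ (i, j)) = (if l = j then 1 else 0)] (mod int p)"
    by metis
  define B where "B = mat n n (\<lambda>(l, i). b l i)"
  have B: "B \<in> carrier_mat n n"
    by (simp add: B_def)
  have "(B * A) $$ (l, j) = (\<Sum>i<n. b l i * A $$ (i, j))" if "l < n" "j < n" for l j
    using that A by (auto simp: B_def scalar_prod_def atLeast0LessThan intro!: sum.cong)
  then have "[det (B * A) = det (1\<^sub>m n)] (mod int p)"
    using A B b by (intro det_cong[where n = n]) auto
  then have inverse: "[det B * det A = 1] (mod int p)"
    using det_mult[OF B A] by simp
  have "\<not> int p dvd det A"
  proof
    assume "int p dvd det A"
    then have "int p dvd 1"
      using inverse cong_dvd_iff by (metis dvd_mult)
    then show False
      using prime_gt_1_nat[OF p] by simp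
  qed
  moreover have "A $$ (i, j) \<in> {0..<int p}" if "i < n" "j < n" for i j
    using that S_range[OF g_in] prime_gt_0_nat[OF p] by (auto simp: A_def)
  moreover have "inj_on h \<sigma>"
    using h_inj inj_on_subset by (auto simp: S_def)
  moreover have "h ` \<sigma> \<subseteq> {..<n}"
    using h_less by (auto simp: S_def)
  moreover have "A $$ (h w, j) = w j" if "w \<in> \<sigma>" "j < n" for w j
    using A_row that by (simp add: S_def)
  ultimately show thesis
    using that[of A h] A by blast
qed

section \<open>Transfer from characteristic two\<close>

lemma universal_complex_subset_if_large_prime:
  assumes p: "prime p" and large: "(real n + 1) ^ (n + 1) < 4 ^ n * (real p)\<^sup>2"
  shows "universal_complex 2 n \<subseteq> universal_complex p n"
proof
  fix \<sigma> assume \<sigma>: "\<sigma> \<in> universal_complex 2 n"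
  obtain A h where A: "A \<in> carrier_mat n n" and odd: "\<not> int 2 dvd det A"
    and A_range: "\<And>i j. i < n \<Longrightarrow> j < n \<Longrightarrow> A $$ (i, j) \<in> {0..<int 2}"
    and h: "inj_on h \<sigma>" "h ` \<sigma> \<subseteq> {..<n}"
    and A_row: "\<And>w j. w \<in> \<sigma> \<Longrightarrow> j < n \<Longrightarrow> A $$ (h w, j) = w j"
    using square_matrix_extending_independent[OF two_is_prime_nat \<sigma>] by metis
  have "A $$ (i, j) \<in> {0, 1}" if "i < n" "j < n" for i j
    using A_range[OF that] by auto
  from det_zero_one_matrix_bound[OF A this] large
  have "4 ^ n * (real_of_int (det A))\<^sup>2 < 4 ^ n * (real p)\<^sup>2"
    by (rule le_less_trans)
  then have "(real_of_int (det A))\<^sup>2 < (real p)\<^sup>2"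
    by simp
  then have "\<bar>real_of_int (det A)\<bar>\<^sup>2 < (real p)\<^sup>2"
    by simp
  then have "\<bar>real_of_int (det A)\<bar> < real p"
    by (rule power_less_imp_less_base) simp
  then have "\<bar>det A\<bar> < int p"
    by linarith
  moreover have "det A \<noteq> 0"
    using odd by auto
  ultimately have not_dvd: "\<not> int p dvd det A"
    using zdvd_not_zless[of "\<bar>det A\<bar>" "int p"] by auto
  interpret V: vectorspace "residue_ring (int p)" "Fp_space p n"
    using Fp_vectorspace[OF p] .
  have fin: "finite \<sigma>" and "\<sigma> \<subseteq> carrier (Fp_space 2 n)"
    using \<sigma> by (auto simp: universal_complex_def)
  moreover have "carrier (Fp_space 2 n) \<subseteq> carrier (Fp_space p n)"
    unfolding carrier_Fp_space[OF p] carrier_Fp_space[OF two_is_prime_nat]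
    using prime_ge_2_nat[OF p] by (intro PiE_mono) auto
  ultimately have carr: "\<sigma> \<subseteq> carrier (Fp_space p n)"
    by blast
  have "V.lin_indpt \<sigma>"
  proof
    assume "V.lin_dep \<sigma>"
    then obtain T a v where T: "finite T" "T \<subseteq> \<sigma>" "a \<in> T \<rightarrow> carrier (residue_ring (int p))"
      "V.lincomb a T = \<zero>\<^bsub>Fp_space p n\<^esub>" "v \<in> T" "a v \<noteq> \<zero>\<^bsub>residue_ring (int p)\<^esub>"
      unfolding V.lin_dep_def by metis
    have h_T: "inj_on h T" "h ` T \<subseteq> {..<n}"
      using h T(2) inj_on_subset by auto
    \<comment> \<open>The coefficients of the dependence become a vector indexed by the rows of \<open>A\<close>.\<close>
    define d where "d i = (if i \<in> h ` T then a (inv_into T h i) else 0)" for i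
    have d_h: "d (h w) = a w" if "w \<in> T" for w
      using that h_T(1) by (simp add: d_def)
    have d_dvd: "int p dvd (\<Sum>i<n. d i * A $$ (i, j))" if j: "j < n" for j
    proof -
      have "(\<Sum>i<n. d i * A $$ (i, j)) = (\<Sum>i\<in>h ` T. d i * A $$ (i, j))"
        using h_T(2) by (intro sum.mono_neutral_right) (auto simp: d_def)
      also have "\<dots> = (\<Sum>w\<in>T. a w * w j)"
        using T(2) j by (auto simp: sum.reindex[OF h_T(1)] d_h A_row intro!: sum.cong)
      also have "\<dots> mod int p = 0"
        using lincomb_Fp_space[OF p T(1) _ T(3) j] T carr j
        by (auto simp: V.func_space_def residue_ring_simps)
      finally show ?thesis
        by (simp add: dvd_eq_mod_eq_0)
    qed
    have "prime (int p)" "h v < n"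
      using p h_T(2) T(5) by auto
    then have "int p dvd d (h v)"
      using dvd_coeffs_if_not_dvd_det[where d = d, OF A _ not_dvd d_dvd] by blast
    then have "int p dvd a v"
      using T(5) by (simp add: d_h)
    moreover have "0 \<le> a v" "a v < int p" "a v \<noteq> 0"
      using T(3,5,6) by (auto simp: residue_ring_simps)
    ultimately show False
      using zdvd_not_zless[of "a v" "int p"] by auto
  qed
  then show "\<sigma> \<in> universal_complex p n"
    using fin carr by (simp add: universal_complex_def)
qed

text \<open>
  Squaring the bound on \<open>p\<close> removes the half-integral exponent and turns it into the hypothesis of
  \<open>universal_complex_subset_if_large_prime\<close>.
\<close>

theorem proposition4p11:
  fixes K :: "'a set set" and m p :: nat
  assumes "simplicial_complex K"
    and "finite (vertices K)"
    and "card (vertices K) = m"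
    and "prime p"
    and "real p >
      real_of_int (int m - buchstaber 2 K + 1) powr
        (real_of_int (int m - buchstaber 2 K + 1) / 2) /
      2 powr real_of_int (int m - buchstaber 2 K)"
  shows "buchstaber 2 K \<le> buchstaber p K"
proof -
  define r where "r = buchstaber_rank 2 K"
  have m_minus: "int m - buchstaber 2 K = int r"
    using assms(3) by (simp add: buchstaber_def r_def)
  have "(real r + 1) powr ((real r + 1) / 2) < 2 ^ r * real p"
    using assms(5) unfolding m_minus by (simp add: powr_realpow field_simps)
  then have "((real r + 1) powr ((real r + 1) / 2))\<^sup>2 < (2 ^ r * real p)\<^sup>2"
    by (intro power_strict_mono) auto
  moreover have "((real r + 1) powr ((real r + 1) / 2))\<^sup>2 = (real r + 1) powr real (r + 1)"
    by (simp add: power2_eq_square flip: powr_add) (simp add: add.commute)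
  moreover have "(real r + 1) powr real (r + 1) = (real r + 1) ^ (r + 1)"
    by (rule powr_realpow) simp
  moreover have "(2 ^ r * real p)\<^sup>2 = 4 ^ r * (real p)\<^sup>2"
    by (simp add: power_mult_distrib) (simp add: power2_eq_square flip: power_mult_distrib)
  ultimately have subset: "universal_complex 2 r \<subseteq> universal_complex p r"
    by (intro universal_complex_subset_if_large_prime[OF assms(4)]) simp
  obtain f where "nondegenerate_map K (universal_complex 2 r) f"
    using buchstaber_rank_attained[OF two_is_prime_nat assms(1,2)] unfolding r_def by blast
  then have "nondegenerate_map K (universal_complex p r) f"
    using subset by (auto simp: nondegenerate_map_def simplicial_map_def)
  then have "buchstaber_rank p K \<le> r"
    unfolding buchstaber_rank_def by (intro Least_le) blast
  then show ?thesis
    by (simp add: buchstaber_def r_def)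
qed

end
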